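(* Let $m\ge3$ and let $B_1,\ldots,B_m$ be bounded selfadjoint operators on a complex Hilbert space $\mathcal{H}$ such that $\{B_1,\ldots,B_m\}$ satisfies Hypotheses (HM). Then $\{B_1,\ldots,B_m\}$ is a strongly indefinite set.
   Context: $(\mathcal{H},\langle\cdot,\cdot\rangle)$ is a complex Hilbert space. A bounded selfadjoint operator $T$ is indefinite if there exist $x_+,x_-\in\mathcal{H}$ with $\langle Tx_+,x_+\rangle>0$ and $\langle Tx_-,x_-\rangle<0$. For selfadjoint $B_1,\ldots,B_m$ put $Q_p=\{x\in\mathcal{H}:\langle B_px,x\rangle=0\}$, $\mathcal{P}_p^+=\{x\in\mathcal{H}:\langle B_px,x\rangle>0\}$, $\mathcal{P}_p^-=\{x\in\mathcal{H}:\langle B_px,x\rangle<0\}$. $\{B_1,\ldots,B_m\}$ (regarded as a family indexed by $1,\ldots,m$) is weakly indefinite if $\sum_{p=1}^m\mu_pB_p$ is indefinite for every $(\mu_1,\ldots,\mu_m)\in\mathbb{R}^m\setminus\{0\}$. Hypotheses (HM), for $m\ge3$: $\{B_1,\ldots,B_m\}$ is weakly indefinite, and whenever $\mathcal{S}$ is a real subspace of $\mathcal{H}$ with (real) dimension $2$ and $\{p,j,k\}\subset\{1,\ldots,m\}$ is a trio of distinct indices such that $\mathcal{S}\cap Q_p\cap Q_j\cap Q_k=\{0\}$, there exists $(\lambda_p,\lambda_j,\lambda_k)\in\mathbb{R}^3\setminus\{0\}$ such that $B:=\lambda_pB_p+\lambda_jB_j+\lambda_kB_k$ satisfies $B\ge0$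 in $\mathcal{S}$ and $B\ne0$ in $\mathcal{S}$; that is, $\langle Bx,x\rangle\ge0$ for all $x\in\mathcal{S}$ and the quadratic form $x\mapsto\langle Bx,x\rangle$ is not identically zero on $\mathcal{S}$. For $m\ge2$, $\{B_1,\ldots,B_m\}$ is strongly indefinite if (1) it is weakly indefinite; and (2) for all $p,j,k\in\{1,\ldots,m\}$ and all $x_+\in\mathcal{P}_p^+\cap Q_j\cap Q_k$, $x_-\in\mathcal{P}_p^-\cap Q_j\cap Q_k$, there exists $\theta\in[0,\pi)$ such that each of $B_j$ and $B_k$ is definite in $\{\alpha x_-+\beta e^{i\theta}x_+:\alpha,\beta\in\mathbb{R}\}$, where "$B$ is definite in a set $S$" means that $\langle Bx,x\rangle\ge0$ for all $x\in S$ or $\langle Bx,x\rangle\le 0$ for all $x\in S$. Equivalently, in (2) there exists $\theta\in[0,\pi)$ with $\operatorname{Re}\langle B_jx_+,e^{i\theta}x_-\rangle=\operatorname{Re}\langle B_kx_+,e^{i\theta}x_-\rangle=0$ (here $i$ in the exponent is the imaginary unit). *)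

theory Defs
  imports "HOL-Analysis.Analysis"
begin

class complex_vector = real_vector +
  fixes scaleC :: "complex \<Rightarrow> 'a \<Rightarrow> 'a"  (infixr "*\<^sub>C" 75)
  assumes scaleC_add_right: "c *\<^sub>C (x + y) = c *\<^sub>C x + c *\<^sub>C y"
    and scaleC_add_left: "(c + d) *\<^sub>C x = c *\<^sub>C x + d *\<^sub>C x"
    and scaleC_scaleC: "c *\<^sub>C d *\<^sub>C x = (c * d) *\<^sub>C x"
    and scaleC_one: "1 *\<^sub>C x = x"
    and scaleR_scaleC: "r *\<^sub>R x = complex_of_real r *\<^sub>C x"

text \<open>The inner product is linear in its first argument. Being the norm of the inner product,
  \<open>norm\<close> satisfies the axioms of \<^class>\<open>real_normed_vector\<close> automatically; they are
  inherited only to make the topology and completeness notions of the library available.\<close>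

class complex_inner = complex_vector + real_normed_vector +
  fixes cinner :: "'a \<Rightarrow> 'a \<Rightarrow> complex"
  assumes cinner_commute: "cinner x y = cnj (cinner y x)"
    and cinner_add_left: "cinner (x + y) z = cinner x z + cinner y z"
    and cinner_scaleC_left: "cinner (c *\<^sub>C x) y = c * cinner x y"
    and cinner_ge_zero: "0 \<le> Re (cinner x x)"
    and cinner_eq_zero_iff: "cinner x x = 0 \<longleftrightarrow> x = 0"
    and norm_eq_sqrt_cinner: "norm x = sqrt (Re (cinner x x))"

class complex_hilbert_space = complex_inner + complete_space

instantiation complex :: complex_hilbert_space
begin

definition scaleC_complex :: "complex \<Rightarrow> complex \<Rightarrow> complex"
  where "scaleC_complex c x = c * x"

definition cinner_complex :: "complex \<Rightarrow> complex \<Rightarrow> complex"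
  where "cinner_complex x y = x * cnj y"

instance
  by standard (simp_all add: scaleC_complex_def cinner_complex_def algebra_simps
      scaleR_conv_of_real cmod_def power2_eq_square)

end

definition bounded_clinear :: "('a::complex_inner \<Rightarrow> 'a) \<Rightarrow> bool"
  where "bounded_clinear T \<longleftrightarrow> bounded_linear T \<and> (\<forall>c x. T (c *\<^sub>C x) = c *\<^sub>C T x)"

definition bounded_selfadjoint :: "('a::complex_inner \<Rightarrow> 'a) \<Rightarrow> bool"
  where "bounded_selfadjoint T \<longleftrightarrow>
    bounded_clinear T \<and> (\<forall>x y. cinner (T x) y = cinner x (T y))"

text \<open>For selfadjoint \<open>T\<close> the number \<open>cinner (T x) x\<close> is real, so conditions on its sign
  are expressed through its real part.\<close>

definition indefinite :: "('a::complex_inner \<Rightarrow> 'a) \<Rightarrow> bool"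
  where "indefinite T \<longleftrightarrow>
    (\<exists>xp xn. Re (cinner (T xp) xp) > 0 \<and> Re (cinner (T xn) xn) < 0)"

definition neutral_set :: "('a::complex_inner \<Rightarrow> 'a) \<Rightarrow> 'a set"
  where "neutral_set T = {x. cinner (T x) x = 0}"

definition positive_set :: "('a::complex_inner \<Rightarrow> 'a) \<Rightarrow> 'a set"
  where "positive_set T = {x. Re (cinner (T x) x) > 0}"

definition negative_set :: "('a::complex_inner \<Rightarrow> 'a) \<Rightarrow> 'a set"
  where "negative_set T = {x. Re (cinner (T x) x) < 0}"

definition definite_in :: "('a::complex_inner \<Rightarrow> 'a) \<Rightarrow> 'a set \<Rightarrow> bool"
  where "definite_in T S \<longleftrightarrow>
    (\<forall>x\<in>S. Re (cinner (T x) x) \<ge> 0) \<or> (\<forall>x\<in>S. Re (cinner (T x) x) \<le> 0)"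

text \<open>A family \<open>B\<^sub>1, \<dots>, B\<^sub>m\<close> is a function on \<^typ>\<open>nat\<close>, of which only the values on
  \<open>{1..m}\<close> matter.\<close>

definition weakly_indefinite :: "nat \<Rightarrow> (nat \<Rightarrow> 'a::complex_inner \<Rightarrow> 'a) \<Rightarrow> bool"
  where "weakly_indefinite m B \<longleftrightarrow>
    (\<forall>\<mu> :: nat \<Rightarrow> real. (\<exists>p\<in>{1..m}. \<mu> p \<noteq> 0) \<longrightarrow>
      indefinite (\<lambda>x. \<Sum>p=1..m. \<mu> p *\<^sub>R B p x))"

text \<open>\<^const>\<open>subspace\<close> and \<^const>\<open>dim\<close> refer to the underlying real vector space.\<close>

definition hypotheses_HM :: "nat \<Rightarrow> (nat \<Rightarrow> 'a::complex_inner \<Rightarrow> 'a) \<Rightarrow> bool"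
  where "hypotheses_HM m B \<longleftrightarrow>
    weakly_indefinite m B \<and>
    (\<forall>S. \<forall>p\<in>{1..m}. \<forall>j\<in>{1..m}. \<forall>k\<in>{1..m}.
      subspace S \<and> dim S = 2 \<and> p \<noteq> j \<and> p \<noteq> k \<and> j \<noteq> k \<and>
      S \<inter> neutral_set (B p) \<inter> neutral_set (B j) \<inter> neutral_set (B k) = {0} \<longrightarrow>
      (\<exists>a b c :: real. (a, b, c) \<noteq> (0, 0, 0) \<and>
        (let T = (\<lambda>x. a *\<^sub>R B p x + b *\<^sub>R B j x + c *\<^sub>R B k x) in
          (\<forall>x\<in>S. Re (cinner (T x) x) \<ge> 0) \<and> (\<exists>x\<in>S. cinner (T x) x \<noteq> 0))))"

text \<open>The indices \<open>p\<close>, \<open>j\<close>, \<open>k\<close> below are not required to be distinct.\<close>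

definition strongly_indefinite :: "nat \<Rightarrow> (nat \<Rightarrow> 'a::complex_inner \<Rightarrow> 'a) \<Rightarrow> bool"
  where "strongly_indefinite m B \<longleftrightarrow>
    weakly_indefinite m B \<and>
    (\<forall>p\<in>{1..m}. \<forall>j\<in>{1..m}. \<forall>k\<in>{1..m}.
      \<forall>xp \<in> positive_set (B p) \<inter> neutral_set (B j) \<inter> neutral_set (B k).
      \<forall>xn \<in> negative_set (B p) \<inter> neutral_set (B j) \<inter> neutral_set (B k).
      \<exists>\<theta>\<in>{0..<pi}.
        let L = {\<alpha> *\<^sub>R xn + \<beta> *\<^sub>R (cis \<theta> *\<^sub>C xp) | \<alpha> \<beta>. True} in
          definite_in (B j) L \<and> definite_in (B k) L)"

end

theory Submission
  imports Defs
begin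

text \<open>Let \<open>p\<close>, \<open>j\<close>, \<open>k\<close> be distinct and let \<open>S\<close> be the real span of \<open>x\<^sub>-\<close> and \<open>x\<^sub>+\<close>. On \<open>S\<close> the
  forms of \<open>B\<^sub>j\<close> and \<open>B\<^sub>k\<close> are multiples of \<open>\<alpha>\<beta>\<close>. If one of them is nonzero, then \<open>S\<close> meets the
  three neutral sets only in \<open>0\<close>; but a combination of the three forms that is nonnegative on
  \<open>S\<close> has no \<open>B\<^sub>p\<close> part, as is seen at \<open>x\<^sub>-\<close> and \<open>x\<^sub>+\<close>, so it is a multiple of \<open>\<alpha>\<beta>\<close> and vanishes,
  contradicting (HM). Hence \<open>\<theta> = 0\<close> works. If \<open>j = k\<close>, a rotation removes the only cross
  term; if \<open>p \<in> {j, k}\<close>, there are no \<open>x\<^sub>\<plusminus>\<close>.\<close>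

lemma cinner_add_right: "cinner x (y + z) = cinner x y + cinner x (z::'a::complex_inner)"
  by (metis cinner_commute cinner_add_left complex_cnj_add)

lemma cinner_scaleC_right: "cinner x (c *\<^sub>C y) = cnj c * cinner x (y::'a::complex_inner)"
  by (metis cinner_commute cinner_scaleC_left complex_cnj_mult)

lemma cinner_scaleR_left: "cinner (r *\<^sub>R x) y = of_real r * cinner x (y::'a::complex_inner)"
  by (simp add: scaleR_scaleC cinner_scaleC_left)

lemma cinner_scaleR_right: "cinner x (r *\<^sub>R y) = of_real r * cinner x (y::'a::complex_inner)"
  by (simp add: scaleR_scaleC cinner_scaleC_right)

lemma bounded_selfadjoint_Im_form:
  assumes "bounded_selfadjoint T"
  shows "Im (cinner (T x) x) = 0"
proof -
  have "cinner (T x) x = cnj (cinner (T x) x)"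
    using assms cinner_commute[of x "T x"] unfolding bounded_selfadjoint_def by simp
  then show ?thesis
    by (metis cnj.simps(2) equal_neg_zero)
qed

text \<open>Neutrality is a complex equation, while signs are read off the real part.
  Selfadjointness makes the form real and so links the two.\<close>

lemma neutral_set_iff_Re:
  assumes "bounded_selfadjoint T"
  shows "x \<in> neutral_set T \<longleftrightarrow> Re (cinner (T x) x) = 0"
  using bounded_selfadjoint_Im_form[OF assms, of x]
  by (auto simp: neutral_set_def complex_eq_iff)

text \<open>The two mixed terms have the same real part by selfadjointness, so a single cross term
  governs the form on a real plane.\<close>

lemma Re_form_combination:
  assumes "bounded_selfadjoint T"
  shows "Re (cinner (T (\<alpha> *\<^sub>R x + \<beta> *\<^sub>R y)) (\<alpha> *\<^sub>R x + \<beta> *\<^sub>R y)) =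
    \<alpha>\<^sup>2 * Re (cinner (T x) x) + \<beta>\<^sup>2 * Re (cinner (T y) y) + 2 * \<alpha> * \<beta> * Re (cinner (T y) x)"
proof -
  have sa: "cinner (T u) v = cinner u (T v)" for u v
    using assms unfolding bounded_selfadjoint_def by blast
  have lin: "linear T"
    using assms unfolding bounded_selfadjoint_def bounded_clinear_def
    by (blast intro: bounded_linear.linear)
  have "Re (cinner (T x) y) = Re (cinner (T y) x)"
    using cinner_commute[of x "T y"] sa[of x y] by simp
  then show ?thesis
    by (simp add: linear_add[OF lin] linear_scale[OF lin] cinner_add_left cinner_add_right
        cinner_scaleR_left cinner_scaleR_right power2_eq_square algebra_simps)
qed

text \<open>With \<open>c = cis \<theta>\<close> the factor is 1, so rotating a neutral vector
  leaves it neutral.\<close>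

lemma Re_form_scaleC:
  assumes "bounded_selfadjoint T"
  shows "Re (cinner (T (c *\<^sub>C x)) (c *\<^sub>C x)) = (cmod c)\<^sup>2 * Re (cinner (T x) x)"
proof -
  have "cinner (T (c *\<^sub>C x)) (c *\<^sub>C x) = (c * cnj c) * cinner (T x) x"
    using assms
    by (simp add: bounded_selfadjoint_def bounded_clinear_def cinner_scaleC_left
        cinner_scaleC_right mult.assoc)
  then show ?thesis
    by (simp add: complex_norm_square[symmetric] flip: of_real_power)
qed

text \<open>Intermediate value theorem: at \<open>pi\<close> the function takes the negative of its
  value \<open>Re a\<close> at 0. If \<open>Re a\<close> is nonzero, the root cannot be
  \<open>pi\<close>, whence the half-open interval.\<close>

lemma exists_rotation_Re_eq_0: "\<exists>\<theta>\<in>{0..<pi}. Re (cis \<theta> * a) = 0"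
proof (cases "Re a = 0")
  case True
  then show ?thesis by (intro bexI[of _ 0]) auto
next
  case False
  let ?f = "\<lambda>\<theta>. Re (cis \<theta> * a)"
  have cont: "continuous_on {0..pi} ?f"
    by (auto intro!: continuous_intros)
  have "\<exists>\<theta>\<ge>0. \<theta> \<le> pi \<and> ?f \<theta> = 0"
  proof (cases "Re a > 0")
    case True
    then show ?thesis using IVT2'[OF _ _ _ cont, of 0] by auto
  next
    case False
    then show ?thesis using IVT'[OF _ _ _ cont, of 0] by auto
  qed
  then obtain \<theta> where \<theta>: "0 \<le> \<theta>" "\<theta> \<le> pi" "?f \<theta> = 0" by blast
  with False have "\<theta> \<noteq> pi" by auto
  with \<theta> show ?thesis by (intro bexI[of _ \<theta>]) auto
qed

lemma span_pair: "span {x, y} = {\<alpha> *\<^sub>R x + \<beta> *\<^sub>R y | \<alpha> \<beta>. True}"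
proof -
  have "z \<in> span {x, y} \<longleftrightarrow> (\<exists>\<alpha> \<beta>. z = \<alpha> *\<^sub>R x + \<beta> *\<^sub>R y)" for z
    unfolding span_breakdown_eq[of z x] span_singleton
    by (auto simp: algebra_simps image_iff)
  then show ?thesis by blast
qed

lemma cross_terms_vanish:
  assumes sa: "bounded_selfadjoint T" "bounded_selfadjoint U" "bounded_selfadjoint V"
    and x: "x \<in> negative_set T" "x \<in> neutral_set U" "x \<in> neutral_set V"
    and y: "y \<in> positive_set T" "y \<in> neutral_set U" "y \<in> neutral_set V"
    and HM: "\<And>S. subspace S \<Longrightarrow> dim S = 2 \<Longrightarrow>
      S \<inter> neutral_set T \<inter> neutral_set U \<inter> neutral_set V = {0} \<Longrightarrow>
      \<exists>a b c :: real.
        (\<forall>x\<in>S. Re (cinner (a *\<^sub>R T x + b *\<^sub>R U x + c *\<^sub>R V x) x) \<ge> 0) \<and>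
        (\<exists>x\<in>S. cinner (a *\<^sub>R T x + b *\<^sub>R U x + c *\<^sub>R V x) x \<noteq> 0)"
  shows "Re (cinner (U y) x) = 0 \<and> Re (cinner (V y) x) = 0"
proof (rule ccontr)
  assume nz: "\<not> ?thesis"
  let ?S = "span {x, y}"
  have Tx: "Re (cinner (T x) x) < 0" and Ty: "Re (cinner (T y) y) > 0"
    using x y by (auto simp: negative_set_def positive_set_def)
  have U: "Re (cinner (U (\<alpha> *\<^sub>R x + \<beta> *\<^sub>R y)) (\<alpha> *\<^sub>R x + \<beta> *\<^sub>R y)) = 2 * \<alpha> * \<beta> * Re (cinner (U y) x)"
    for \<alpha> \<beta> using x y by (simp add: Re_form_combination sa neutral_set_def)
  have V: "Re (cinner (V (\<alpha> *\<^sub>R x + \<beta> *\<^sub>R y)) (\<alpha> *\<^sub>R x + \<beta> *\<^sub>R y)) = 2 * \<alpha> * \<beta> * Re (cinner (V y) x)"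
    for \<alpha> \<beta> using x y by (simp add: Re_form_combination sa neutral_set_def)
  note T = Re_form_combination[OF sa(1), of _ x _ y]
  \<comment> \<open>When \<open>\<alpha> * \<beta> = 0\<close> the cross term drops out, and at most
    one square remains, multiplied by a nonzero value of the form of \<open>T\<close>.\<close>
  have indep: "\<alpha> = 0 \<and> \<beta> = 0"
    if "\<alpha> *\<^sub>R x + \<beta> *\<^sub>R y \<in> neutral_set T" and "\<alpha> * \<beta> = 0" for \<alpha> \<beta>
    using that Tx Ty T[of \<alpha> \<beta>] by (auto simp: neutral_set_iff_Re sa)
  \<comment> \<open>A real multiple of \<open>y\<close> has a nonnegative value of the form of
    \<open>T\<close>, but \<open>x\<close> has a negative one.\<close>
  have "independent {x, y}"
  proof -
    have "x \<noteq> r *\<^sub>R y" for r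
    proof
      assume "x = r *\<^sub>R y"
      then have "Re (cinner (T x) x) = r\<^sup>2 * Re (cinner (T y) y)"
        using T[of 0 r] by simp
      then show False using Tx Ty by (smt (verit) mult_nonneg_nonneg zero_le_power2)
    qed
    moreover have "y \<noteq> 0"
      using Ty T[of 0 0] by auto
    ultimately show ?thesis
      by (auto simp: independent_insert span_singleton)
  qed
  moreover have "x \<noteq> y" using Tx Ty by auto
  ultimately have dim: "dim ?S = 2"
    by (simp add: dim_eq_card_independent)
  have "z = 0" if zS: "z \<in> ?S \<inter> neutral_set T \<inter> neutral_set U \<inter> neutral_set V" for z
  proof -
    obtain \<alpha> \<beta> where z: "z = \<alpha> *\<^sub>R x + \<beta> *\<^sub>R y"
      using zS unfolding span_pair by blast
    \<comment> \<open>By \<open>nz\<close> one of the two cross coefficients is nonzero; neutrality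
      for that operator forces the product to vanish.\<close>
    have "\<alpha> * \<beta> = 0"
      using zS nz U[of \<alpha> \<beta>] V[of \<alpha> \<beta>] by (auto simp: z neutral_set_iff_Re sa)
    then show ?thesis
      using indep[of \<alpha> \<beta>] zS by (simp add: z)
  qed
  moreover have "0 \<in> ?S \<inter> neutral_set T \<inter> neutral_set U \<inter> neutral_set V"
    using T[of 0 0] U[of 0 0] V[of 0 0] by (simp add: neutral_set_iff_Re sa span_zero)
  ultimately have "?S \<inter> neutral_set T \<inter> neutral_set U \<inter> neutral_set V = {0}"
    by blast
  from HM[OF subspace_span dim this] obtain a b c z where
    nonneg: "\<And>x. x \<in> ?S \<Longrightarrow> Re (cinner (a *\<^sub>R T x + b *\<^sub>R U x + c *\<^sub>R V x) x) \<ge> 0"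
    and z: "z \<in> ?S" "cinner (a *\<^sub>R T z + b *\<^sub>R U z + c *\<^sub>R V z) z \<noteq> 0"
    by blast
  let ?d = "b * Re (cinner (U y) x) + c * Re (cinner (V y) x)"
  have form: "a * Re (cinner (T w) w) + b * Re (cinner (U w) w) + c * Re (cinner (V w) w)
      = Re (cinner (a *\<^sub>R T w + b *\<^sub>R U w + c *\<^sub>R V w) w)" for w
    by (simp add: cinner_add_left cinner_scaleR_left)
  \<comment> \<open>At \<open>x\<close> and \<open>y\<close> the forms of \<open>U\<close> and
    \<open>V\<close> vanish, so only the \<open>T\<close> part is left, with opposite signs.\<close>
  have "a * Re (cinner (T x) x) \<ge> 0" "a * Re (cinner (T y) y) \<ge> 0"
    using nonneg[of x] nonneg[of y] x y form[of x] form[of y]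
    by (simp_all add: span_base neutral_set_def)
  then have a: "a = 0"
    using Tx Ty by (simp add: zero_le_mult_iff)
  have val: "Re (cinner (a *\<^sub>R T w + b *\<^sub>R U w + c *\<^sub>R V w) w) = 2 * \<alpha> * \<beta> * ?d"
    if "w = \<alpha> *\<^sub>R x + \<beta> *\<^sub>R y" for w \<alpha> \<beta>
    unfolding form[symmetric] unfolding a that U V by (simp add: algebra_simps)
  \<comment> \<open>The sum and the difference of \<open>x\<close> and \<open>y\<close> give
    \<open>?d\<close> opposite signs. The coefficients 1 and -1 are spelled out so that
    \<open>val\<close> matches.\<close>
  have plus: "1 *\<^sub>R x + 1 *\<^sub>R y \<in> ?S" and minus: "1 *\<^sub>R x + (-1) *\<^sub>R y \<in> ?S"
    unfolding span_pair by blast+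
  have zero: "d = 0" if "0 \<le> 2 * 1 * 1 * d" "0 \<le> 2 * 1 * (-1) * d" for d :: real
    using that by simp
  have "?d = 0"
    by (rule zero[OF nonneg[OF plus, unfolded val[OF refl]] nonneg[OF minus, unfolded val[OF refl]]])
  obtain \<alpha> \<beta> where z': "z = \<alpha> *\<^sub>R x + \<beta> *\<^sub>R y"
    using z unfolding span_pair by blast
  have "Re (cinner (a *\<^sub>R T z + b *\<^sub>R U z + c *\<^sub>R V z) z) = 0"
    unfolding val[OF z'] \<open>?d = 0\<close> by (rule mult_zero_right)
  \<comment> \<open>\<open>z\<close> was chosen with a nonzero complex value, so the imaginary part
    must be excluded as well.\<close>
  moreover have "Im (cinner (a *\<^sub>R T z + b *\<^sub>R U z + c *\<^sub>R V z) z) = 0"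
    by (simp add: cinner_add_left cinner_scaleR_left bounded_selfadjoint_Im_form sa)
  ultimately show False
    using z(2) by (simp add: complex_eq_iff)
qed

text \<open>Both diagonal terms vanish, and the rotation multiplies the cross term by
  \<open>cis \<theta>\<close>, making its real part 0. The form is thus identically zero on the
  plane.\<close>

lemma definite_in_rotated_plane:
  assumes T: "bounded_selfadjoint T" and "x \<in> neutral_set T" "y \<in> neutral_set T"
    and "Re (cis \<theta> * cinner (T y) x) = 0"
  shows "definite_in T {\<alpha> *\<^sub>R x + \<beta> *\<^sub>R (cis \<theta> *\<^sub>C y) | \<alpha> \<beta>. True}"
proof -
  have "cinner (T (cis \<theta> *\<^sub>C y)) x = cis \<theta> * cinner (T y) x"
    using T by (simp add: bounded_selfadjoint_def bounded_clinear_def cinner_scaleC_left)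
  then have "Re (cinner (T (cis \<theta> *\<^sub>C y)) x) = 0"
    using assms(4) by simp
  moreover have "Re (cinner (T (cis \<theta> *\<^sub>C y)) (cis \<theta> *\<^sub>C y)) = 0" "Re (cinner (T x) x) = 0"
    using assms by (simp_all add: Re_form_scaleC[OF T] neutral_set_def)
  ultimately show ?thesis
    by (auto simp: definite_in_def Re_form_combination[OF T])
qed

theorem proposition5p1:
  fixes B :: "nat \<Rightarrow> 'a::complex_hilbert_space \<Rightarrow> 'a" and m :: nat
  assumes "m \<ge> 3"
    and "\<And>p. p \<in> {1..m} \<Longrightarrow> bounded_selfadjoint (B p)"
    and "hypotheses_HM m B"
  shows "strongly_indefinite m B"
proof -
  have "\<exists>\<theta>\<in>{0..<pi}.
      definite_in (B j) {\<alpha> *\<^sub>R xn + \<beta> *\<^sub>R (cis \<theta> *\<^sub>C xp) | \<alpha> \<beta>. True} \<and>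
      definite_in (B k) {\<alpha> *\<^sub>R xn + \<beta> *\<^sub>R (cis \<theta> *\<^sub>C xp) | \<alpha> \<beta>. True}"
    if pjk: "p \<in> {1..m}" "j \<in> {1..m}" "k \<in> {1..m}"
      and xp: "xp \<in> positive_set (B p) \<inter> neutral_set (B j) \<inter> neutral_set (B k)"
      and xn: "xn \<in> negative_set (B p) \<inter> neutral_set (B j) \<inter> neutral_set (B k)"
    for p j k xp xn
  proof -
    note sa = assms(2)[OF pjk(1)] assms(2)[OF pjk(2)] assms(2)[OF pjk(3)]
    have "\<exists>\<theta>\<in>{0..<pi}. Re (cis \<theta> * cinner (B j xp) xn) = 0 \<and> Re (cis \<theta> * cinner (B k xp) xn) = 0"
    proof (cases "j = k")
      case True
      then show ?thesis using exists_rotation_Re_eq_0 by simp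
    next
      case False
      \<comment> \<open>No vector is both positive and neutral for \<open>B p\<close>.\<close>
      have "p \<noteq> j" "p \<noteq> k"
        using xp by (auto simp: positive_set_def neutral_set_def)
      with False pjk assms(3)
      have HM: "\<exists>a b c :: real.
          (\<forall>x\<in>S. Re (cinner (a *\<^sub>R B p x + b *\<^sub>R B j x + c *\<^sub>R B k x) x) \<ge> 0) \<and>
          (\<exists>x\<in>S. cinner (a *\<^sub>R B p x + b *\<^sub>R B j x + c *\<^sub>R B k x) x \<noteq> 0)"
        if "subspace S" "dim S = 2"
          "S \<inter> neutral_set (B p) \<inter> neutral_set (B j) \<inter> neutral_set (B k) = {0}" for S
        using that unfolding hypotheses_HM_def Let_def by blast
      have "Re (cinner (B j xp) xn) = 0 \<and> Re (cinner (B k xp) xn) = 0"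
        using xp xn by (intro cross_terms_vanish[OF sa _ _ _ _ _ _ HM]) auto
      then show ?thesis
        by (intro bexI[of _ 0]) auto
    qed
    then obtain \<theta> where \<theta>: "\<theta> \<in> {0..<pi}"
      "Re (cis \<theta> * cinner (B j xp) xn) = 0" "Re (cis \<theta> * cinner (B k xp) xn) = 0"
      by blast
    have neutral: "xn \<in> neutral_set (B j)" "xp \<in> neutral_set (B j)"
      "xn \<in> neutral_set (B k)" "xp \<in> neutral_set (B k)"
      using xp xn by blast+
    show ?thesis
      using definite_in_rotated_plane[OF sa(2) neutral(1,2) \<theta>(2)]
        definite_in_rotated_plane[OF sa(3) neutral(3,4) \<theta>(3)] \<theta>(1)
      by (intro bexI[of _ \<theta>] conjI)
  qed
  moreover have "weakly_indefinite m B"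
    using assms(3) by (simp add: hypotheses_HM_def)
  ultimately show ?thesis
    unfolding strongly_indefinite_def Let_def by blast
qed

end
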